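(* Let $D\ge 1$, $\sigma_1,\dots,\sigma_D>0$, $\lambda>0$, and consider the stationary RHMC and HMC chains for the Gaussian target with potential $\Phi(q)=\sum_{i=1}^D\frac{q_i^2}{2\sigma_i^2}$ (complete momentum randomization). Then, for each $1\le i\le D$, the integrated autocorrelation time of the estimator of the mean of the $i$th component is, for RHMC with mean duration $\lambda$, $$\mathrm{IAC}_i^{\mathrm{RHMC}}=1+2\,\frac{\sigma_i^2}{\lambda^2},$$ and, for HMC with constant duration $\lambda$ not an integer multiple of $\pi\sigma_i$, $$\mathrm{IAC}_i^{\mathrm{HMC}}=\frac{1+\cos(\lambda/\sigma_i)}{1-\cos(\lambda/\sigma_i)}.$$
   Context: Chains: with $t_0=0$, $t_{n+1}=t_n+\delta t_n$, $$q_i(t_{n+1})=\cos\!\Big(\frac{\delta t_n}{\sigma_i}\Big)q_i(t_n)+\sigma_i\sin\!\Big(\frac{\delta t_n}{\sigma_i}\Big)\xi_{i,n},\qquad 1\le i\le D,\ n\ge 0,$$ where $\xi_{i,n}$ are i.i.d. $\mathcal N(0,1)$. For RHMC the $\delta t_n$ are i.i.d. exponential with mean $\lambda$ (the same $\delta t_n$ for all components), independent of the $\xi_{i,n}$; for HMC, $\delta t_n=\lambda$ is constant. The chain is started at stationarity: $q_i(0)\sim\mathcal N(0,\sigma_i^2)$, independent across $i$ and independent of all $\delta t_n,\xi_{i,n}$. The estimator of the mean is $\hat f_{i,N}=\frac{1}{N+1}\sum_{j=0}^Nq_i(t_j)$. Its asymptotic variance is the constant $\hat\sigma_i^2$ such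 that $\mathrm{Var}(\hat f_{i,N})$ behaves as $\hat\sigma_i^2/N$ when $N\to\infty$, computed by $\hat\sigma_i^2=\mathrm{Var}(q_i(0))+2\sum_{j=1}^\infty\mathrm{cov}(q_i(0),q_i(t_j))$ when this series converges absolutely. The integrated autocorrelation time is $\mathrm{IAC}_i=\hat\sigma_i^2/\sigma_i^2$. *)

theory Defs
  imports "HOL-Probability.Probability"
begin

section \<open>The Gaussian target\<close>

definition gaussian_potential :: "nat \<Rightarrow> (nat \<Rightarrow> real) \<Rightarrow> (nat \<Rightarrow> real) \<Rightarrow> real" where
  "gaussian_potential D \<sigma> q = (\<Sum>i=1..D. (q i)\<^sup>2 / (2 * (\<sigma> i)\<^sup>2))"

text \<open>The next lemmas tie the chain below to the potential: the product of centred normal laws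
  is the distribution with density proportional to \<open>exp (- \<Phi>)\<close>, and the position update of
  the chain is the exact solution of \<open>q' = p\<close>, \<open>p' = - \<nabla>\<Phi>(q)\<close>.\<close>

lemma gaussian_potential_density:
  assumes "\<forall>i\<in>{1..D}. \<sigma> i > 0"
  shows "(\<Prod>i=1..D. normal_density 0 (\<sigma> i) (q i)) =
    exp (- gaussian_potential D \<sigma> q) / (\<Prod>i=1..D. sqrt (2 * pi * (\<sigma> i)\<^sup>2))"
  unfolding gaussian_potential_def normal_density_def
  by (simp add: sum_negf[symmetric] exp_sum prod_dividef prod.distrib)

lemma gaussian_potential_partial_derivative:
  assumes "i \<in> {1..D}" and "\<sigma> i > 0"
  shows "((\<lambda>x. gaussian_potential D \<sigma> (q(i := x))) has_real_derivative q i / (\<sigma> i)\<^sup>2) (at (q i))"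
proof -
  have eq: "gaussian_potential D \<sigma> (q(i := x)) =
      x\<^sup>2 / (2 * (\<sigma> i)\<^sup>2) + (\<Sum>j\<in>{1..D}-{i}. (q j)\<^sup>2 / (2 * (\<sigma> j)\<^sup>2))" for x
    unfolding gaussian_potential_def using assms by (simp add: sum.remove[of _ i])
  show ?thesis
    unfolding eq using assms(2)
    by (auto intro!: derivative_eq_intros simp: field_simps power2_eq_square)
qed

lemma hamiltonian_flow_position:
  assumes "s > (0::real)"
  shows "((\<lambda>t. cos (t / s) * x + s * sin (t / s) * p) has_real_derivative
      (cos (t / s) * p - sin (t / s) * x / s)) (at t)"
  using assms by (auto intro!: derivative_eq_intros simp: field_simps)

lemma hamiltonian_flow_momentum:
  assumes "s > (0::real)"
  shows "((\<lambda>t. cos (t / s) * p - sin (t / s) * x / s) has_real_derivative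
      - ((cos (t / s) * x + s * sin (t / s) * p) / s\<^sup>2)) (at t)"
  using assms by (auto intro!: derivative_eq_intros simp: field_simps power2_eq_square)


section \<open>The HMC and RHMC chains\<close>

text \<open>\<open>chain_position \<sigma> q0 \<xi> dt i n\<close> is the random variable \<open>q\<^sub>i(t\<^sub>n)\<close>, where
  \<open>t\<^sub>0 = 0\<close> and \<open>t\<^sub>n\<^sub>+\<^sub>1 = t\<^sub>n + dt n\<close>. The same duration \<open>dt n\<close> is used for all components.\<close>

primrec chain_position ::
  "(nat \<Rightarrow> real) \<Rightarrow> (nat \<Rightarrow> 'a \<Rightarrow> real) \<Rightarrow> (nat \<Rightarrow> nat \<Rightarrow> 'a \<Rightarrow> real) \<Rightarrow> (nat \<Rightarrow> 'a \<Rightarrow> real)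
    \<Rightarrow> nat \<Rightarrow> nat \<Rightarrow> 'a \<Rightarrow> real" where
  "chain_position \<sigma> q0 \<xi> dt i 0 = q0 i"
| "chain_position \<sigma> q0 \<xi> dt i (Suc n) =
    (\<lambda>\<omega>. cos (dt n \<omega> / \<sigma> i) * chain_position \<sigma> q0 \<xi> dt i n \<omega>
        + \<sigma> i * sin (dt n \<omega> / \<sigma> i) * \<xi> i n \<omega>)"

datatype source = Init nat | Noise nat nat | Duration nat

fun source_variable ::
  "(nat \<Rightarrow> 'a \<Rightarrow> real) \<Rightarrow> (nat \<Rightarrow> nat \<Rightarrow> 'a \<Rightarrow> real) \<Rightarrow> (nat \<Rightarrow> 'a \<Rightarrow> real)
    \<Rightarrow> source \<Rightarrow> 'a \<Rightarrow> real" where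
  "source_variable q0 \<xi> dt (Init i) = q0 i"
| "source_variable q0 \<xi> dt (Noise i n) = \<xi> i n"
| "source_variable q0 \<xi> dt (Duration n) = dt n"

definition sources :: "nat \<Rightarrow> source set" where
  "sources D = {Init i |i. i \<in> {1..D}} \<union> {Noise i n |i n. i \<in> {1..D}} \<union> range Duration"

definition stationary_chain ::
  "'a measure \<Rightarrow> nat \<Rightarrow> (nat \<Rightarrow> real) \<Rightarrow> (nat \<Rightarrow> 'a \<Rightarrow> real) \<Rightarrow> (nat \<Rightarrow> nat \<Rightarrow> 'a \<Rightarrow> real)
    \<Rightarrow> (nat \<Rightarrow> 'a \<Rightarrow> real) \<Rightarrow> bool" where
  "stationary_chain M D \<sigma> q0 \<xi> dt \<longleftrightarrow>
    prob_space M \<and>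
    prob_space.indep_vars M (\<lambda>_. borel) (source_variable q0 \<xi> dt) (sources D) \<and>
    (\<forall>i\<in>{1..D}. distributed M lborel (q0 i) (normal_density 0 (\<sigma> i))) \<and>
    (\<forall>i\<in>{1..D}. \<forall>n. distributed M lborel (\<xi> i n) std_normal_density)"

text \<open>The rate of an exponential law with mean \<open>l\<close> is \<open>1 / l\<close>.\<close>

definition stationary_RHMC ::
  "'a measure \<Rightarrow> nat \<Rightarrow> (nat \<Rightarrow> real) \<Rightarrow> real \<Rightarrow> (nat \<Rightarrow> 'a \<Rightarrow> real)
    \<Rightarrow> (nat \<Rightarrow> nat \<Rightarrow> 'a \<Rightarrow> real) \<Rightarrow> (nat \<Rightarrow> 'a \<Rightarrow> real) \<Rightarrow> bool" where
  "stationary_RHMC M D \<sigma> l q0 \<xi> dt \<longleftrightarrow>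
    stationary_chain M D \<sigma> q0 \<xi> dt \<and>
    (\<forall>n. distributed M lborel (dt n) (exponential_density (1 / l)))"

text \<open>Constant durations are independent of everything, so their presence among the sources
  is no restriction for HMC.\<close>

definition stationary_HMC ::
  "'a measure \<Rightarrow> nat \<Rightarrow> (nat \<Rightarrow> real) \<Rightarrow> real \<Rightarrow> (nat \<Rightarrow> 'a \<Rightarrow> real)
    \<Rightarrow> (nat \<Rightarrow> nat \<Rightarrow> 'a \<Rightarrow> real) \<Rightarrow> (nat \<Rightarrow> 'a \<Rightarrow> real) \<Rightarrow> bool" where
  "stationary_HMC M D \<sigma> l q0 \<xi> dt \<longleftrightarrow>
    stationary_chain M D \<sigma> q0 \<xi> dt \<and> (\<forall>n. dt n = (\<lambda>_. l))"


section \<open>Asymptotic variance and integrated autocorrelation time\<close>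

definition covariance :: "'a measure \<Rightarrow> ('a \<Rightarrow> real) \<Rightarrow> ('a \<Rightarrow> real) \<Rightarrow> real" where
  "covariance M X Y =
    (\<integral>\<omega>. (X \<omega> - (\<integral>\<omega>'. X \<omega>' \<partial>M)) * (Y \<omega> - (\<integral>\<omega>'. Y \<omega>' \<partial>M)) \<partial>M)"

definition mean_estimator :: "(nat \<Rightarrow> 'a \<Rightarrow> real) \<Rightarrow> nat \<Rightarrow> 'a \<Rightarrow> real" where
  "mean_estimator X N \<omega> = (\<Sum>j=0..N. X j \<omega>) / (real N + 1)"

definition has_asymptotic_variance :: "'a measure \<Rightarrow> (nat \<Rightarrow> 'a \<Rightarrow> real) \<Rightarrow> real \<Rightarrow> bool" where
  "has_asymptotic_variance M X v \<longleftrightarrow>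
    (\<lambda>N. real N * prob_space.variance M (mean_estimator X N)) \<longlonglongrightarrow> v"

definition asymptotic_variance :: "'a measure \<Rightarrow> (nat \<Rightarrow> 'a \<Rightarrow> real) \<Rightarrow> real" where
  "asymptotic_variance M X = (THE v. has_asymptotic_variance M X v)"

definition autocovariance_summable :: "'a measure \<Rightarrow> (nat \<Rightarrow> 'a \<Rightarrow> real) \<Rightarrow> bool" where
  "autocovariance_summable M X \<longleftrightarrow> summable (\<lambda>j. \<bar>covariance M (X 0) (X (Suc j))\<bar>)"

definition autocovariance_series :: "'a measure \<Rightarrow> (nat \<Rightarrow> 'a \<Rightarrow> real) \<Rightarrow> real" where
  "autocovariance_series M X =
    prob_space.variance M (X 0) + 2 * (\<Sum>j. covariance M (X 0) (X (Suc j)))"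

text \<open>For a stationary chain, normalised by the variance \<open>s\<^sup>2\<close> of a single sample.\<close>

definition IAC :: "'a measure \<Rightarrow> real \<Rightarrow> (nat \<Rightarrow> 'a \<Rightarrow> real) \<Rightarrow> real" where
  "IAC M s X = asymptotic_variance M X / s\<^sup>2"

end

theory Submission
  imports Defs "HOL-Real_Asymp.Real_Asymp"
begin

text \<open>Given its past and the duration, the position after one move has mean
  \<open>cos (\<delta>t / \<sigma>)\<close> times the present position, because the refreshed noise is centred.
  The duration is independent of the past as well, so averaging over it shows that each step
  multiplies \<open>cov (q\<^sub>m, q\<^sub>m\<^sub>+\<^sub>k)\<close> by \<open>a = E [cos (\<delta>t / \<sigma>)]\<close> (lemma
  \<open>chain_product_step\<close>). The identity \<open>cos\<^sup>2 + sin\<^sup>2 = 1\<close> keeps the second moment at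
  \<open>\<sigma>\<^sup>2\<close> (lemma \<open>chain_moments\<close>), hence the autocovariances are \<open>\<sigma>\<^sup>2 a ^ k\<close>.

  For \<open>\<bar>a\<bar> < 1\<close> the geometric series gives \<open>\<sigma>\<^sup>2 (1 + 2 a / (1 - a)) =
  \<sigma>\<^sup>2 (1 + a) / (1 - a)\<close>, and a closed form for the variance of the partial sums shows that
  this is the limit of \<open>N\<close> times the variance of the estimator
  (lemma \<open>geometric_autocovariance_IAC\<close>). A constant duration \<open>l\<close> has
  \<open>a = cos (l / \<sigma>)\<close>, with modulus below 1 exactly when \<open>l\<close> is no integer multiple of
  \<open>\<pi> \<sigma>\<close>. An exponential duration of mean \<open>l\<close> has \<open>a = \<sigma>\<^sup>2 / (\<sigma>\<^sup>2 + l\<^sup>2)\<close>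
  (lemma \<open>exponential_expectation_cos\<close>), so that
  \<open>(1 + a) / (1 - a) = 1 + 2 \<sigma>\<^sup>2 / l\<^sup>2\<close>.\<close>

section \<open>Stationary sequences with geometric autocovariance\<close>

text \<open>Adding the next term to the partial sum adds the new variance \<open>v\<close> and twice a finite
  geometric sum of cross terms, so the closed form follows by induction without rearranging a
  double sum over \<open>\<bar>j - k\<bar>\<close>. Its main term is linear in \<open>N\<close>; when \<open>\<bar>a\<bar> < 1\<close> the
  correction stays bounded.\<close>

lemma partial_sum_second_moment_geometric:
  fixes X :: "nat \<Rightarrow> 'a \<Rightarrow> real"
  assumes int: "\<And>j k. integrable M (\<lambda>\<omega>. X j \<omega> * X k \<omega>)"
    and cov: "\<And>j k. (\<integral>\<omega>. X j \<omega> * X (j + k) \<omega> \<partial>M) = v * a ^ k"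
    and "a \<noteq> 1"
  shows "integrable M (\<lambda>\<omega>. (\<Sum>j=0..N. X j \<omega>)\<^sup>2)"
    and "(\<integral>\<omega>. (\<Sum>j=0..N. X j \<omega>)\<^sup>2 \<partial>M) =
      v * ((real N + 1) * ((1 + a) / (1 - a)) - 2 * a * (1 - a ^ Suc N) / (1 - a)\<^sup>2)"
proof -
  show int_sq: "integrable M (\<lambda>\<omega>. (\<Sum>j=0..N. X j \<omega>)\<^sup>2)" for N
    unfolding power2_eq_square sum_product by (intro Bochner_Integration.integrable_sum int)
  show "(\<integral>\<omega>. (\<Sum>j=0..N. X j \<omega>)\<^sup>2 \<partial>M) =
      v * ((real N + 1) * ((1 + a) / (1 - a)) - 2 * a * (1 - a ^ Suc N) / (1 - a)\<^sup>2)"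
  proof (induction N)
    case 0
    have "1 + a - 2 * a = 1 - a" by simp
    then show ?case using cov[of 0 0] \<open>a \<noteq> 1\<close>
      by (simp add: power2_eq_square diff_divide_distrib[symmetric])
  next
    case (Suc N)
    have cross: "(\<Sum>j=0..N. \<integral>\<omega>. X j \<omega> * X (Suc N) \<omega> \<partial>M) = v * (a * (1 - a ^ Suc N) / (1 - a))"
    proof -
      have "(\<Sum>j=0..N. \<integral>\<omega>. X j \<omega> * X (Suc N) \<omega> \<partial>M) = (\<Sum>j=0..N. v * a ^ (Suc N - j))"
      proof (rule sum.cong)
        fix j assume "j \<in> {0..N}"
        then show "(\<integral>\<omega>. X j \<omega> * X (Suc N) \<omega> \<partial>M) = v * a ^ (Suc N - j)"
          using cov[of j "Suc N - j"] by simp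
      qed simp
      also have "\<dots> = (\<Sum>j=0..N. v * a * a ^ j)"
        by (subst sum.atLeastAtMost_rev) (intro sum.cong, auto simp: Suc_diff_le)
      also have "\<dots> = v * a * (\<Sum>j<Suc N. a ^ j)"
        by (simp add: sum_distrib_left lessThan_Suc_atMost atLeast0AtMost)
      also have "\<dots> = v * (a * (1 - a ^ Suc N) / (1 - a))"
        using \<open>a \<noteq> 1\<close> sum_gp_strict[of a "Suc N"] by (simp only: if_False) simp
      finally show ?thesis .
    qed
    have "(\<integral>\<omega>. (\<Sum>j=0..Suc N. X j \<omega>)\<^sup>2 \<partial>M) =
        (\<integral>\<omega>. (\<Sum>j=0..N. X j \<omega>)\<^sup>2 + 2 * (\<Sum>j=0..N. X j \<omega> * X (Suc N) \<omega>)
          + X (Suc N) \<omega> * X (Suc N) \<omega> \<partial>M)"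
      by (intro Bochner_Integration.integral_cong)
        (auto simp: power2_eq_square sum_distrib_right[symmetric] algebra_simps)
    also have "\<dots> = (\<integral>\<omega>. (\<Sum>j=0..N. X j \<omega>)\<^sup>2 \<partial>M)
        + 2 * (\<Sum>j=0..N. \<integral>\<omega>. X j \<omega> * X (Suc N) \<omega> \<partial>M)
        + (\<integral>\<omega>. X (Suc N) \<omega> * X (Suc N) \<omega> \<partial>M)"
      using int int_sq by (simp add: Bochner_Integration.integral_sum)
    also have "\<dots> = v * ((real N + 1) * ((1 + a) / (1 - a)) - 2 * a * (1 - a ^ Suc N) / (1 - a)\<^sup>2)
        + 2 * (v * (a * (1 - a ^ Suc N) / (1 - a))) + v"
      using cov[of "Suc N" 0] by (simp only: Suc.IH cross) simp
    also have "\<dots> = v * ((real (Suc N) + 1) * ((1 + a) / (1 - a))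
        - 2 * a * (1 - a ^ Suc (Suc N)) / (1 - a)\<^sup>2)"
    proof -
      \<comment> \<open>What remains is a rational identity in \<open>1 - a\<close>, \<open>a ^ Suc N\<close> and \<open>N + 1\<close>, treated
        as independent atoms.\<close>
      define b p x where "b = 1 - a" and "p = a ^ Suc N" and "x = real N + 1"
      have b: "b \<noteq> 0" and a: "a = 1 - b" using \<open>a \<noteq> 1\<close> by (auto simp: b_def)
      have "v * (x * ((1 + a) / b) - 2 * a * (1 - p) / b\<^sup>2) + 2 * (v * (a * (1 - p) / b)) + v =
          v * ((x + 1) * ((1 + a) / b) - 2 * a * (1 - a * p) / b\<^sup>2)"
        using b unfolding a by (simp add: divide_simps power2_eq_square) algebra
      then show ?thesis unfolding b_def p_def x_def by (simp add: add.commute)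
    qed
    finally show ?case .
  qed
qed

text \<open>The autocovariance series is a geometric series, and the linear term of the preceding
  closed form has exactly its sum as coefficient; the bounded correction disappears after
  division by \<open>N\<close>.\<close>

lemma (in prob_space) geometric_autocovariance_IAC:
  fixes X :: "nat \<Rightarrow> 'a \<Rightarrow> real"
  assumes int1: "\<And>j. integrable M (X j)"
    and int2: "\<And>j k. integrable M (\<lambda>\<omega>. X j \<omega> * X k \<omega>)"
    and mean: "\<And>j. expectation (X j) = 0"
    and cov: "\<And>j k. expectation (\<lambda>\<omega>. X j \<omega> * X (j + k) \<omega>) = s\<^sup>2 * a ^ k"
    and a: "\<bar>a\<bar> < 1" and s: "s \<noteq> 0"
  shows "autocovariance_summable M X"
    and "has_asymptotic_variance M X (autocovariance_series M X)"
    and "IAC M s X = (1 + a) / (1 - a)"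
proof -
  have a1: "a \<noteq> 1" using a by auto
  have C: "covariance M (X 0) (X (Suc j)) = s\<^sup>2 * a * a ^ j" for j
    using cov[of 0 "Suc j"] by (simp add: covariance_def mean)
  have "summable (\<lambda>j. \<bar>s\<^sup>2 * a\<bar> * \<bar>a\<bar> ^ j)"
    using a by (intro summable_mult summable_geometric) simp
  then show "autocovariance_summable M X"
    by (simp add: autocovariance_summable_def C abs_mult power_abs)
  have "(\<Sum>j. s\<^sup>2 * a * a ^ j) = s\<^sup>2 * a * (1 / (1 - a))"
    using a by (subst suminf_mult) (auto intro!: summable_geometric simp: suminf_geometric)
  then have series: "autocovariance_series M X = s\<^sup>2 * ((1 + a) / (1 - a))"
    using cov[of 0 0] a1
    by (simp add: autocovariance_series_def C mean power2_eq_square divide_simps) algebra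
  have E: "expectation (mean_estimator X N) = 0" for N
    using int1 by (simp add: mean_estimator_def[abs_def] Bochner_Integration.integral_sum mean)
  have var: "variance (mean_estimator X N) =
      s\<^sup>2 * ((real N + 1) * ((1 + a) / (1 - a)) - 2 * a * (1 - a ^ Suc N) / (1 - a)\<^sup>2)
        / (real N + 1)\<^sup>2" for N
    using partial_sum_second_moment_geometric(2)[OF int2 cov a1, of N]
    unfolding E by (simp add: mean_estimator_def[abs_def] power_divide)
  have "(\<lambda>N. s\<^sup>2 * ((1 + a) / (1 - a) * (real N / (real N + 1))
        - 2 * a * (1 - a ^ Suc N) / (1 - a)\<^sup>2 * (real N / (real N + 1)\<^sup>2)))
      \<longlonglongrightarrow> s\<^sup>2 * ((1 + a) / (1 - a) * 1 - 2 * a * (1 - 0) / (1 - a)\<^sup>2 * 0)"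
  proof (intro tendsto_intros)
    show "(\<lambda>N. real N / (real N + 1)) \<longlonglongrightarrow> 1"
      using LIMSEQ_n_over_Suc_n by (simp add: add.commute)
    have "(\<lambda>N. real N / (real N + 1) * inverse (real (Suc N))) \<longlonglongrightarrow> 1 * 0"
      by (intro tendsto_mult LIMSEQ_inverse_real_of_nat)
        (use LIMSEQ_n_over_Suc_n in \<open>simp add: add.commute\<close>)
    then show "(\<lambda>N. real N / (real N + 1)\<^sup>2) \<longlonglongrightarrow> 0"
      by (simp add: power2_eq_square field_simps)
    show "(\<lambda>N. a ^ Suc N) \<longlonglongrightarrow> 0"
      using LIMSEQ_power_zero[of a] a by (intro LIMSEQ_Suc) simp
  qed (use a1 in auto)
  moreover have "s\<^sup>2 * (c * (real N / (real N + 1)) - d * (real N / (real N + 1)\<^sup>2)) =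
      real N * (s\<^sup>2 * ((real N + 1) * c - d) / (real N + 1)\<^sup>2)" for c d N
  proof -
    have "real N + 1 \<noteq> 0" by linarith
    then show ?thesis by (simp add: divide_simps power2_eq_square) algebra
  qed
  ultimately have lim: "has_asymptotic_variance M X (s\<^sup>2 * ((1 + a) / (1 - a)))"
    unfolding has_asymptotic_variance_def var by (simp only: mult_1_right mult_zero_right diff_zero)
  then show "has_asymptotic_variance M X (autocovariance_series M X)"
    by (simp add: series)
  have "asymptotic_variance M X = s\<^sup>2 * ((1 + a) / (1 - a))"
    unfolding asymptotic_variance_def using lim
    by (intro the_equality) (auto simp: has_asymptotic_variance_def intro: LIMSEQ_unique)
  then show "IAC M s X = (1 + a) / (1 - a)"
    using s by (simp add: IAC_def)
qed

section \<open>Moments of the driving laws\<close>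

lemma (in prob_space) centred_normal_moments:
  assumes s: "s > 0" and X: "distributed M lborel X (normal_density 0 s)"
  shows "integrable M (\<lambda>\<omega>. (X \<omega>)\<^sup>2)" and "integrable M X"
    and "expectation X = 0" and "expectation (\<lambda>\<omega>. (X \<omega>)\<^sup>2) = s\<^sup>2"
proof -
  show "integrable M (\<lambda>\<omega>. (X \<omega>)\<^sup>2)"
    using distributed_integrable[OF X, of "\<lambda>x. x\<^sup>2"] integrable_normal_moment[OF s, of 0 2]
    by simp
  show "integrable M X"
    using distributed_integrable[OF X, of "\<lambda>x. x"] integrable_normal_moment[OF s, of 0 1]
    by simp
  show "expectation X = 0" by (rule normal_distributed_expectation[OF s X])
  then show "expectation (\<lambda>\<omega>. (X \<omega>)\<^sup>2) = s\<^sup>2"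
    using normal_distributed_variance[OF s X] by simp
qed

text \<open>The integrand \<open>1 + cos\<close> is used in place of \<open>cos\<close> because it is nonnegative: the
  fundamental theorem of calculus on a half-line then yields integrability and the value at
  once, and subtracting the total mass 1 recovers the cosine.\<close>

lemma (in prob_space) exponential_expectation_cos:
  assumes r: "r > 0" and X: "distributed M lborel X (exponential_density r)"
  shows "expectation (\<lambda>\<omega>. cos (w * X \<omega>)) = r\<^sup>2 / (r\<^sup>2 + w\<^sup>2)"
proof -
  define f where "f x = r * exp (- (r * x)) * (1 + cos (w * x))" for x
  define c where "c = r / (r\<^sup>2 + w\<^sup>2)"
  define F where "F x = - exp (- (r * x)) +
    c * exp (- (r * x)) * (w * sin (w * x) - r * cos (w * x))" for x
  have pos: "r\<^sup>2 + w\<^sup>2 > 0" using r by (simp add: add_pos_nonneg)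
  have nonneg: "f x \<ge> 0" for x
  proof -
    have "1 + cos (w * x) \<ge> 0" using cos_ge_minus_one[of "w * x"] by linarith
    then show ?thesis using r by (simp add: f_def)
  qed
  have deriv: "(F has_real_derivative f x) (at x)" for x
  proof -
    have "(F has_real_derivative r * exp (- (r * x)) +
        c * (exp (- (r * x)) * cos (w * x) * (r\<^sup>2 + w\<^sup>2))) (at x)"
      unfolding F_def
      by (auto intro!: derivative_eq_intros simp: algebra_simps power2_eq_square)
    moreover have "c * (r\<^sup>2 + w\<^sup>2) = r" using pos by (simp add: c_def)
    then have "c * (exp (- (r * x)) * cos (w * x) * (r\<^sup>2 + w\<^sup>2)) = r * exp (- (r * x)) * cos (w * x)"
      by (metis mult.assoc mult.commute)
    ultimately show ?thesis by (simp add: f_def algebra_simps)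
  qed
  have lim: "(F \<longlongrightarrow> 0) at_top"
  proof -
    have e: "((\<lambda>x. (1 + c * (\<bar>w\<bar> + r)) * exp (- (r * x))) \<longlongrightarrow> 0) at_top"
      using r by real_asymp
    have "norm (F x) \<le> (1 + c * (\<bar>w\<bar> + r)) * exp (- (r * x))" for x
    proof -
      have c: "c \<ge> 0" using r pos by (simp add: c_def)
      have "\<bar>w * sin (w * x) - r * cos (w * x)\<bar> \<le> \<bar>w * sin (w * x)\<bar> + \<bar>r * cos (w * x)\<bar>"
        by (rule abs_triangle_ineq4)
      also have "\<dots> \<le> \<bar>w\<bar> * 1 + r * 1"
        using r unfolding abs_mult by (intro add_mono mult_mono) auto
      finally have "c * exp (- (r * x)) * \<bar>w * sin (w * x) - r * cos (w * x)\<bar> \<le>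
          c * exp (- (r * x)) * (\<bar>w\<bar> + r)"
        using c by (intro mult_left_mono) auto
      moreover have "norm (F x) \<le> \<bar>- exp (- (r * x))\<bar> +
          \<bar>c * exp (- (r * x)) * (w * sin (w * x) - r * cos (w * x))\<bar>"
        unfolding F_def real_norm_def by (rule abs_triangle_ineq)
      then have "norm (F x) \<le> exp (- (r * x)) +
          c * exp (- (r * x)) * \<bar>w * sin (w * x) - r * cos (w * x)\<bar>"
        using c unfolding abs_mult by simp
      ultimately have "norm (F x) \<le> exp (- (r * x)) + c * exp (- (r * x)) * (\<bar>w\<bar> + r)"
        by linarith
      also have "\<dots> = (1 + c * (\<bar>w\<bar> + r)) * exp (- (r * x))"
        by (simp only: algebra_simps mult_1)
      finally show ?thesis .
    qed
    then show ?thesis by (intro Lim_null_comparison[OF _ e] always_eventually) simp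
  qed
  have "(\<integral>\<^sup>+x. ennreal (f x) * indicator {0..} x \<partial>lborel) = ennreal (0 - F 0)"
    using deriv nonneg lim by (intro nn_integral_FTC_atLeast) (auto simp: f_def)
  moreover have "0 - F 0 = 1 + r\<^sup>2 / (r\<^sup>2 + w\<^sup>2)"
    by (simp add: F_def c_def power2_eq_square)
  ultimately have "has_bochner_integral lborel (\<lambda>x. f x * indicator {0..} x) (1 + r\<^sup>2 / (r\<^sup>2 + w\<^sup>2))"
    using nonneg
    by (intro has_bochner_integral_nn_integral)
      (auto simp: f_def nn_integral_set_ennreal)
  moreover have "f x * indicator {0..} x = exponential_density r x * (1 + cos (w * x))" for x
    by (simp add: f_def exponential_density_def mult_ac)
  ultimately have "(\<integral>x. exponential_density r x * (1 + cos (w * x)) \<partial>lborel) = 1 + r\<^sup>2 / (r\<^sup>2 + w\<^sup>2)"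
    by (simp add: has_bochner_integral_integral_eq)
  then have "expectation (\<lambda>\<omega>. 1 + cos (w * X \<omega>)) = 1 + r\<^sup>2 / (r\<^sup>2 + w\<^sup>2)"
    using distributed_integral[OF X, of "\<lambda>x. 1 + cos (w * x)"] r
    by (simp add: exponential_density_nonneg)
  moreover have "integrable M (\<lambda>\<omega>. cos (w * X \<omega>))"
    using distributed_measurable[OF X] by (intro integrable_const_bound[of _ 1]) auto
  ultimately show ?thesis by (simp add: prob_space)
qed

section \<open>Second moments of the chain\<close>

text \<open>The strict bound leaves out \<open>Noise i n\<close> and \<open>Duration n\<close>, which drive the move from
  \<open>q\<^sub>n\<close> to \<open>q\<^sub>n\<^sub>+\<^sub>1\<close>, so that they form groups of sources disjoint from this one.\<close>

definition past :: "nat \<Rightarrow> nat \<Rightarrow> source set" where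
  "past i n = insert (Init i) (Noise i ` {..<n} \<union> Duration ` {..<n})"

text \<open>The same recursion run on the space of source values: it exhibits each position as a
  fixed measurable function of finitely many sources, which is what independence of disjoint
  groups of sources can be applied to.\<close>

definition chain_of_sources :: "(nat \<Rightarrow> real) \<Rightarrow> nat \<Rightarrow> nat \<Rightarrow> (source \<Rightarrow> real) \<Rightarrow> real" where
  "chain_of_sources \<sigma> i =
    chain_position \<sigma> (\<lambda>k w. w (Init k)) (\<lambda>k m w. w (Noise k m)) (\<lambda>m w. w (Duration m)) i"

lemma chain_of_sources_measurable:
  "m \<le> n \<Longrightarrow> chain_of_sources \<sigma> i m \<in> borel_measurable (PiM (past i n) (\<lambda>_. borel))"
proof (induction m)
  case 0
  have "(\<lambda>w. w (Init i)) \<in> borel_measurable (PiM (past i n) (\<lambda>_. borel :: real measure))"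
    by (rule measurable_component_singleton) (simp add: past_def)
  then show ?case by (simp add: chain_of_sources_def)
next
  case (Suc m)
  have [measurable]:
    "(\<lambda>w. w (Noise i m)) \<in> borel_measurable (PiM (past i n) (\<lambda>_. borel :: real measure))"
    "(\<lambda>w. w (Duration m)) \<in> borel_measurable (PiM (past i n) (\<lambda>_. borel :: real measure))"
    using Suc.prems by (auto intro!: measurable_component_singleton simp: past_def)
  have [measurable]: "chain_of_sources \<sigma> i m \<in> borel_measurable (PiM (past i n) (\<lambda>_. borel))"
    using Suc by simp
  have "chain_of_sources \<sigma> i (Suc m) = (\<lambda>w. cos (w (Duration m) / \<sigma> i) * chain_of_sources \<sigma> i m w
      + \<sigma> i * sin (w (Duration m) / \<sigma> i) * w (Noise i m))"
    by (simp add: chain_of_sources_def)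
  then show ?case by simp
qed

lemma chain_of_sources_restrict:
  "m \<le> n \<Longrightarrow> chain_of_sources \<sigma> i m (restrict (\<lambda>x. source_variable q0 \<xi> dt x \<omega>) (past i n))
    = chain_position \<sigma> q0 \<xi> dt i m \<omega>"
  by (induction m) (auto simp: chain_of_sources_def past_def)

context
  fixes M :: "'a measure" and D :: nat and \<sigma> :: "nat \<Rightarrow> real"
    and q0 :: "nat \<Rightarrow> 'a \<Rightarrow> real" and \<xi> :: "nat \<Rightarrow> nat \<Rightarrow> 'a \<Rightarrow> real"
    and dt :: "nat \<Rightarrow> 'a \<Rightarrow> real" and i :: nat
  assumes chain: "stationary_chain M D \<sigma> q0 \<xi> dt"
    and i: "i \<in> {1..D}" and \<sigma>: "\<sigma> i > 0"
begin

interpretation prob_space M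
  using chain by (simp add: stationary_chain_def)

abbreviation (input) "q \<equiv> chain_position \<sigma> q0 \<xi> dt i"

lemma sources_indep: "indep_vars (\<lambda>_. borel) (source_variable q0 \<xi> dt) (sources D)"
  using chain by (simp add: stationary_chain_def)

lemma duration_measurable [measurable]: "random_variable borel (dt n)"
proof -
  have "Duration n \<in> sources D" by (simp add: sources_def)
  then have "random_variable borel (source_variable q0 \<xi> dt (Duration n))"
    using sources_indep by (auto simp: indep_vars_def2)
  then show ?thesis by simp
qed

lemma duration_integrable:
  fixes g :: "real \<Rightarrow> real"
  assumes [measurable]: "g \<in> borel_measurable borel" and "\<And>x. \<bar>g x\<bar> \<le> 1"
  shows "integrable M (\<lambda>\<omega>. g (dt n \<omega>))"
  using assms(2) by (intro integrable_const_bound[of _ 1]) auto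

text \<open>All uses of independence go through this factorization. The bound on \<open>u\<close> covers the
  trigonometric functions of the duration and makes them integrable whatever the law of the
  duration is, so RHMC and HMC are treated alike.\<close>

lemma past_duration_noise_factorize:
  fixes F :: "(source \<Rightarrow> real) \<Rightarrow> real" and u v :: "real \<Rightarrow> real"
  assumes F: "F \<in> borel_measurable (PiM (past i n) (\<lambda>_. borel))"
    and F_eq: "\<And>\<omega>. F (restrict (\<lambda>x. source_variable q0 \<xi> dt x \<omega>) (past i n)) = Y \<omega>"
    and u[measurable]: "u \<in> borel_measurable borel" and v[measurable]: "v \<in> borel_measurable borel"
    and u_le: "\<And>x. \<bar>u x\<bar> \<le> 1"
    and int: "integrable M Y" "integrable M (\<lambda>\<omega>. v (\<xi> i n \<omega>))"
  shows "integrable M (\<lambda>\<omega>. u (dt n \<omega>) * Y \<omega> * v (\<xi> i n \<omega>))" (is ?I)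
    and "expectation (\<lambda>\<omega>. u (dt n \<omega>) * Y \<omega> * v (\<xi> i n \<omega>)) =
      expectation (\<lambda>\<omega>. u (dt n \<omega>)) * expectation Y * expectation (\<lambda>\<omega>. v (\<xi> i n \<omega>))" (is ?E)
proof -
  define K where "K j = (if j = 0 then past i n else if j = 1 then {Duration n} else {Noise i n})"
    for j :: nat
  define Z where "Z j = (if j = 0 then F else if j = 1 then (\<lambda>w. u (w (Duration n)))
    else (\<lambda>w. v (w (Noise i n))))" for j :: nat
  define W where "W j \<omega> = Z j (restrict (\<lambda>x. source_variable q0 \<xi> dt x \<omega>) (K j))" for j \<omega>
  have "indep_vars (\<lambda>j. PiM (K j) (\<lambda>_. borel))
      (\<lambda>j \<omega>. restrict (\<lambda>x. source_variable q0 \<xi> dt x \<omega>) (K j)) {0, 1, 2}"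
    using i by (intro indep_vars_restrict[OF sources_indep])
      (auto simp: K_def past_def sources_def disjoint_family_on_def split: if_splits)
  moreover have "Z j \<in> borel_measurable (PiM (K j) (\<lambda>_. borel))" for j
  proof -
    have [measurable]: "(\<lambda>w. w x) \<in> borel_measurable (PiM {x} (\<lambda>_. borel :: real measure))" for x :: source
      by (rule measurable_component_singleton) simp
    show ?thesis using F by (simp add: K_def Z_def)
  qed
  ultimately have ind: "indep_vars (\<lambda>_. borel) W {0, 1, 2}"
    unfolding W_def by (rule indep_vars_compose2)
  have W: "W 0 = Y" "W 1 = (\<lambda>\<omega>. u (dt n \<omega>))" "W 2 = (\<lambda>\<omega>. v (\<xi> i n \<omega>))"
    by (auto simp: W_def Z_def K_def F_eq)
  have duration_int: "integrable M (\<lambda>\<omega>. u (dt n \<omega>))"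
    by (rule duration_integrable[OF u]) (rule u_le)
  have W_int: "integrable M (W j)" if "j \<in> {0, 1, 2}" for j
    using that int duration_int by (auto simp: W simp flip: One_nat_def)
  have prod: "(\<Prod>j\<in>{0, 1, 2}. g j) = g 1 * g 0 * g 2" for g :: "nat \<Rightarrow> real"
    by simp
  have fin: "finite {0, 1, 2::nat}" by simp
  have "integrable M (\<lambda>\<omega>. \<Prod>j\<in>{0, 1, 2}. W j \<omega>)"
    by (rule indep_vars_integrable[OF fin ind W_int])
  then show ?I by (simp only: prod W)
  have "expectation (\<lambda>\<omega>. \<Prod>j\<in>{0, 1, 2}. W j \<omega>) = (\<Prod>j\<in>{0, 1, 2}. expectation (W j))"
    by (rule indep_vars_lebesgue_integral[OF fin ind W_int])
  then show ?E by (simp only: prod W)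
qed

lemma noise_moments:
  "integrable M (\<lambda>\<omega>. (\<xi> i n \<omega>)\<^sup>2)" "integrable M (\<xi> i n)"
  "expectation (\<xi> i n) = 0" "expectation (\<lambda>\<omega>. (\<xi> i n \<omega>)\<^sup>2) = 1"
proof -
  have "distributed M lborel (\<xi> i n) (normal_density 0 1)"
    using chain i by (auto simp: stationary_chain_def)
  from centred_normal_moments[OF _ this]
  show "integrable M (\<lambda>\<omega>. (\<xi> i n \<omega>)\<^sup>2)" "integrable M (\<xi> i n)"
    "expectation (\<xi> i n) = 0" "expectation (\<lambda>\<omega>. (\<xi> i n \<omega>)\<^sup>2) = 1" by auto
qed

text \<open>In the second moment the mixed term vanishes because the noise is centred, and the two
  squares contribute \<open>\<sigma>\<^sup>2 E [cos\<^sup>2] + \<sigma>\<^sup>2 E [sin\<^sup>2]\<close>, the noise having unit variance.\<close>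

lemma chain_moments:
  "integrable M (q n)" "integrable M (\<lambda>\<omega>. (q n \<omega>)\<^sup>2)"
  "expectation (q n) = 0" "expectation (\<lambda>\<omega>. (q n \<omega>)\<^sup>2) = (\<sigma> i)\<^sup>2"
proof (induction n)
  case 0
  have "distributed M lborel (q0 i) (normal_density 0 (\<sigma> i))"
    using chain i by (auto simp: stationary_chain_def)
  from centred_normal_moments[OF \<sigma> this]
  show "integrable M (q 0)" "integrable M (\<lambda>\<omega>. (q 0 \<omega>)\<^sup>2)"
    "expectation (q 0) = 0" "expectation (\<lambda>\<omega>. (q 0 \<omega>)\<^sup>2) = (\<sigma> i)\<^sup>2" by auto
next
  case (Suc n)
  define s where "s = \<sigma> i"
  have [measurable]: "chain_of_sources \<sigma> i n \<in> borel_measurable (PiM (past i n) (\<lambda>_. borel))"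
    by (rule chain_of_sources_measurable) simp
  have trig: "\<bar>cos x\<bar> \<le> 1" "\<bar>sin x\<bar> \<le> 1" "\<bar>(cos x)\<^sup>2\<bar> \<le> 1" "\<bar>(sin x)\<^sup>2\<bar> \<le> 1"
    "\<bar>cos x * sin x\<bar> \<le> 1" for x :: real
    by (auto simp: abs_square_le_1 abs_mult intro!: mult_le_one)
  have F_eq: "chain_of_sources \<sigma> i n (restrict (\<lambda>x. source_variable q0 \<xi> dt x \<omega>) (past i n)) = q n \<omega>" for \<omega>
    by (rule chain_of_sources_restrict) simp
  note factorize = past_duration_noise_factorize[where n = n]
  have A: "integrable M (\<lambda>\<omega>. cos (dt n \<omega> / s) * q n \<omega> * 1)"
    "expectation (\<lambda>\<omega>. cos (dt n \<omega> / s) * q n \<omega> * 1) =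
      expectation (\<lambda>\<omega>. cos (dt n \<omega> / s)) * expectation (q n) * expectation (\<lambda>_. 1)"
    by (rule factorize[where F = "chain_of_sources \<sigma> i n" and u = "\<lambda>x. cos (x / s)" and v = "\<lambda>_. 1"];
      (rule F_eq trig | simp add: Suc))+
  have B: "integrable M (\<lambda>\<omega>. sin (dt n \<omega> / s) * 1 * \<xi> i n \<omega>)"
    "expectation (\<lambda>\<omega>. sin (dt n \<omega> / s) * 1 * \<xi> i n \<omega>) =
      expectation (\<lambda>\<omega>. sin (dt n \<omega> / s)) * expectation (\<lambda>_. 1) * expectation (\<lambda>\<omega>. \<xi> i n \<omega>)"
    by (rule factorize[where F = "\<lambda>_. 1" and Y = "\<lambda>_. 1" and u = "\<lambda>x. sin (x / s)" and v = "\<lambda>x. x"];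
      (rule trig | simp add: noise_moments))+
  \<comment> \<open>The factors 1 keep the summands in the form of the factorization lemma.\<close>
  have q_Suc: "q (Suc n) = (\<lambda>\<omega>. cos (dt n \<omega> / s) * q n \<omega> * 1
      + s * (sin (dt n \<omega> / s) * 1 * \<xi> i n \<omega>))"
    by (simp add: s_def mult.assoc)
  show "integrable M (q (Suc n))" "expectation (q (Suc n)) = 0"
    unfolding q_Suc using A B by (simp_all add: Suc noise_moments)
  have C: "integrable M (\<lambda>\<omega>. (cos (dt n \<omega> / s))\<^sup>2 * (q n \<omega>)\<^sup>2 * 1)"
    "expectation (\<lambda>\<omega>. (cos (dt n \<omega> / s))\<^sup>2 * (q n \<omega>)\<^sup>2 * 1) =
      expectation (\<lambda>\<omega>. (cos (dt n \<omega> / s))\<^sup>2) * expectation (\<lambda>\<omega>. (q n \<omega>)\<^sup>2) * expectation (\<lambda>_. 1)"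
    by (rule factorize[where F = "\<lambda>w. (chain_of_sources \<sigma> i n w)\<^sup>2" and Y = "\<lambda>\<omega>. (q n \<omega>)\<^sup>2"
        and u = "\<lambda>x. (cos (x / s))\<^sup>2" and v = "\<lambda>_. 1"];
      (rule trig | simp add: F_eq Suc))+
  have D: "integrable M (\<lambda>\<omega>. (sin (dt n \<omega> / s))\<^sup>2 * 1 * (\<xi> i n \<omega>)\<^sup>2)"
    "expectation (\<lambda>\<omega>. (sin (dt n \<omega> / s))\<^sup>2 * 1 * (\<xi> i n \<omega>)\<^sup>2) =
      expectation (\<lambda>\<omega>. (sin (dt n \<omega> / s))\<^sup>2) * expectation (\<lambda>_. 1) * expectation (\<lambda>\<omega>. (\<xi> i n \<omega>)\<^sup>2)"
    by (rule factorize[where F = "\<lambda>_. 1" and Y = "\<lambda>_. 1"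
        and u = "\<lambda>x. (sin (x / s))\<^sup>2" and v = "\<lambda>x. x\<^sup>2"];
      (rule trig | simp add: noise_moments))+
  have E: "integrable M (\<lambda>\<omega>. (cos (dt n \<omega> / s) * sin (dt n \<omega> / s)) * q n \<omega> * \<xi> i n \<omega>)"
    "expectation (\<lambda>\<omega>. (cos (dt n \<omega> / s) * sin (dt n \<omega> / s)) * q n \<omega> * \<xi> i n \<omega>) =
      expectation (\<lambda>\<omega>. cos (dt n \<omega> / s) * sin (dt n \<omega> / s)) * expectation (q n)
        * expectation (\<lambda>\<omega>. \<xi> i n \<omega>)"
    by (rule factorize[where F = "chain_of_sources \<sigma> i n"
        and u = "\<lambda>x. cos (x / s) * sin (x / s)" and v = "\<lambda>x. x"];
      (rule F_eq trig | simp add: Suc noise_moments))+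
  have q_Suc_sq: "(\<lambda>\<omega>. (q (Suc n) \<omega>)\<^sup>2) = (\<lambda>\<omega>. (cos (dt n \<omega> / s))\<^sup>2 * (q n \<omega>)\<^sup>2 * 1
      + s\<^sup>2 * ((sin (dt n \<omega> / s))\<^sup>2 * 1 * (\<xi> i n \<omega>)\<^sup>2)
      + 2 * s * (cos (dt n \<omega> / s) * sin (dt n \<omega> / s) * q n \<omega> * \<xi> i n \<omega>))"
    unfolding q_Suc by (simp add: power2_eq_square algebra_simps)
  show "integrable M (\<lambda>\<omega>. (q (Suc n) \<omega>)\<^sup>2)"
    unfolding q_Suc_sq by (intro Bochner_Integration.integrable_add integrable_mult_right C D E)
  have "expectation (\<lambda>\<omega>. (q (Suc n) \<omega>)\<^sup>2) = s\<^sup>2 * (expectation (\<lambda>\<omega>. (cos (dt n \<omega> / s))\<^sup>2)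
      + expectation (\<lambda>\<omega>. (sin (dt n \<omega> / s))\<^sup>2))"
    unfolding q_Suc_sq using C D E
    by (simp add: Suc noise_moments prob_space s_def[symmetric] distrib_left mult.commute)
  also have "expectation (\<lambda>\<omega>. (cos (dt n \<omega> / s))\<^sup>2) + expectation (\<lambda>\<omega>. (sin (dt n \<omega> / s))\<^sup>2)
      = expectation (\<lambda>\<omega>. (cos (dt n \<omega> / s))\<^sup>2 + (sin (dt n \<omega> / s))\<^sup>2)"
    by (rule Bochner_Integration.integral_add[symmetric]; rule duration_integrable;
      (rule trig | simp))
  also have "\<dots> = 1" by (simp add: prob_space)
  finally show "expectation (\<lambda>\<omega>. (q (Suc n) \<omega>)\<^sup>2) = (\<sigma> i)\<^sup>2" by (simp add: s_def)
qed

text \<open>For \<open>m \<le> n\<close> the product \<open>q\<^sub>m q\<^sub>n\<close> is still a function of the past of move \<open>n\<close>,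
  hence independent of its duration; the noise term drops out since the noise is centred.\<close>

lemma chain_product_step:
  assumes int: "integrable M (\<lambda>\<omega>. q m \<omega> * q (m + k) \<omega>)"
  shows "integrable M (\<lambda>\<omega>. q m \<omega> * q (m + Suc k) \<omega>)"
    and "expectation (\<lambda>\<omega>. q m \<omega> * q (m + Suc k) \<omega>) =
      expectation (\<lambda>\<omega>. cos (dt (m + k) \<omega> / \<sigma> i)) * expectation (\<lambda>\<omega>. q m \<omega> * q (m + k) \<omega>)"
proof -
  define n where "n = m + k"
  have [measurable]: "chain_of_sources \<sigma> i n \<in> borel_measurable (PiM (past i n) (\<lambda>_. borel))"
    "chain_of_sources \<sigma> i m \<in> borel_measurable (PiM (past i n) (\<lambda>_. borel))"
    by (rule chain_of_sources_measurable, simp add: n_def)+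
  have m_le: "m \<le> n" by (simp add: n_def)
  have int': "integrable M (\<lambda>\<omega>. q m \<omega> * q n \<omega>)" using int by (simp add: n_def)
  note factorize = past_duration_noise_factorize[where n = n]
  have A: "integrable M (\<lambda>\<omega>. cos (dt n \<omega> / \<sigma> i) * (q m \<omega> * q n \<omega>) * 1)"
    "expectation (\<lambda>\<omega>. cos (dt n \<omega> / \<sigma> i) * (q m \<omega> * q n \<omega>) * 1) =
      expectation (\<lambda>\<omega>. cos (dt n \<omega> / \<sigma> i)) * expectation (\<lambda>\<omega>. q m \<omega> * q n \<omega>) * expectation (\<lambda>_. 1)"
    by (rule factorize[where F = "\<lambda>w. chain_of_sources \<sigma> i m w * chain_of_sources \<sigma> i n w"
        and Y = "\<lambda>\<omega>. q m \<omega> * q n \<omega>" and u = "\<lambda>x. cos (x / \<sigma> i)" and v = "\<lambda>_. 1"];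
      (rule int' | simp add: chain_of_sources_restrict m_le))+
  have B: "integrable M (\<lambda>\<omega>. sin (dt n \<omega> / \<sigma> i) * q m \<omega> * \<xi> i n \<omega>)"
    "expectation (\<lambda>\<omega>. sin (dt n \<omega> / \<sigma> i) * q m \<omega> * \<xi> i n \<omega>) =
      expectation (\<lambda>\<omega>. sin (dt n \<omega> / \<sigma> i)) * expectation (q m) * expectation (\<lambda>\<omega>. \<xi> i n \<omega>)"
    by (rule factorize[where F = "chain_of_sources \<sigma> i m"
        and u = "\<lambda>x. sin (x / \<sigma> i)" and v = "\<lambda>x. x"];
      (simp add: chain_of_sources_restrict m_le chain_moments noise_moments))+
  have eq: "(\<lambda>\<omega>. q m \<omega> * q (m + Suc k) \<omega>) = (\<lambda>\<omega>. cos (dt n \<omega> / \<sigma> i) * (q m \<omega> * q n \<omega>) * 1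
      + \<sigma> i * (sin (dt n \<omega> / \<sigma> i) * q m \<omega> * \<xi> i n \<omega>))"
    by (simp add: n_def algebra_simps)
  show "integrable M (\<lambda>\<omega>. q m \<omega> * q (m + Suc k) \<omega>)"
    unfolding eq by (intro Bochner_Integration.integrable_add integrable_mult_right A B)
  show "expectation (\<lambda>\<omega>. q m \<omega> * q (m + Suc k) \<omega>) =
      expectation (\<lambda>\<omega>. cos (dt (m + k) \<omega> / \<sigma> i)) * expectation (\<lambda>\<omega>. q m \<omega> * q (m + k) \<omega>)"
    unfolding eq using A B by (simp add: n_def noise_moments prob_space)
qed

lemma chain_IAC:
  assumes a: "\<And>n. expectation (\<lambda>\<omega>. cos (dt n \<omega> / \<sigma> i)) = a" and "\<bar>a\<bar> < 1"
  shows "autocovariance_summable M q \<and> has_asymptotic_variance M q (autocovariance_series M q) \<and>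
    IAC M (\<sigma> i) q = (1 + a) / (1 - a)"
proof -
  have cov: "integrable M (\<lambda>\<omega>. q m \<omega> * q (m + k) \<omega>) \<and>
      expectation (\<lambda>\<omega>. q m \<omega> * q (m + k) \<omega>) = (\<sigma> i)\<^sup>2 * a ^ k" for m k
  proof (induction k)
    case 0
    show ?case using chain_moments[of m] by (simp add: power2_eq_square)
  next
    case (Suc k)
    then show ?case using chain_product_step[of m k] by (simp add: a del: add_Suc_right)
  qed
  have int: "integrable M (\<lambda>\<omega>. q m \<omega> * q n \<omega>)" for m n
  proof (cases "m \<le> n")
    case True
    then show ?thesis using cov[of m "n - m"] by simp
  next
    case False
    then show ?thesis using cov[of n "m - n"] by (simp add: mult.commute)
  qed
  show ?thesis
    using geometric_autocovariance_IAC[of q "\<sigma> i" a] chain_moments int cov \<sigma> assms(2) by simp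
qed

end

section \<open>The two autocorrelation times\<close>

theorem mainTheorem9:
  fixes M :: "'a measure" and D :: nat and \<sigma> :: "nat \<Rightarrow> real" and l :: real
    and q0 :: "nat \<Rightarrow> 'a \<Rightarrow> real" and \<xi> :: "nat \<Rightarrow> nat \<Rightarrow> 'a \<Rightarrow> real"
    and dt :: "nat \<Rightarrow> 'a \<Rightarrow> real" and i :: nat
  assumes "D \<ge> 1" and "\<forall>k\<in>{1..D}. \<sigma> k > 0" and "l > 0" and "i \<in> {1..D}"
  shows "(stationary_RHMC M D \<sigma> l q0 \<xi> dt \<longrightarrow>
      autocovariance_summable M (chain_position \<sigma> q0 \<xi> dt i) \<and>
      has_asymptotic_variance M (chain_position \<sigma> q0 \<xi> dt i)
        (autocovariance_series M (chain_position \<sigma> q0 \<xi> dt i)) \<and>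
      IAC M (\<sigma> i) (chain_position \<sigma> q0 \<xi> dt i) = 1 + 2 * ((\<sigma> i)\<^sup>2 / l\<^sup>2)) \<and>
    (stationary_HMC M D \<sigma> l q0 \<xi> dt \<and> (\<forall>k::int. l \<noteq> of_int k * (pi * \<sigma> i)) \<longrightarrow>
      autocovariance_summable M (chain_position \<sigma> q0 \<xi> dt i) \<and>
      has_asymptotic_variance M (chain_position \<sigma> q0 \<xi> dt i)
        (autocovariance_series M (chain_position \<sigma> q0 \<xi> dt i)) \<and>
      IAC M (\<sigma> i) (chain_position \<sigma> q0 \<xi> dt i)
        = (1 + cos (l / \<sigma> i)) / (1 - cos (l / \<sigma> i)))"
proof -
  define s where "s = \<sigma> i"
  have s: "s > 0" "\<sigma> i > 0" using assms by (auto simp: s_def)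
  let ?q = "chain_position \<sigma> q0 \<xi> dt i"
  have RHMC: "autocovariance_summable M ?q \<and>
      has_asymptotic_variance M ?q (autocovariance_series M ?q) \<and>
      IAC M (\<sigma> i) ?q = 1 + 2 * ((\<sigma> i)\<^sup>2 / l\<^sup>2)"
    if "stationary_RHMC M D \<sigma> l q0 \<xi> dt"
  proof -
    from that have chain: "stationary_chain M D \<sigma> q0 \<xi> dt"
      and dt: "\<And>n. distributed M lborel (dt n) (exponential_density (1 / l))"
      by (auto simp: stationary_RHMC_def)
    interpret prob_space M using chain by (simp add: stationary_chain_def)
    define a where "a = s\<^sup>2 / (s\<^sup>2 + l\<^sup>2)"
    have pos: "s\<^sup>2 + l\<^sup>2 > 0" using s by (simp add: add_pos_nonneg)
    have "expectation (\<lambda>\<omega>. cos (dt n \<omega> / \<sigma> i)) = a" for n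
    proof -
      have "(1 / l)\<^sup>2 / ((1 / l)\<^sup>2 + (1 / s)\<^sup>2) = a"
        using s \<open>l > 0\<close> pos by (simp add: a_def field_simps)
      then show ?thesis
        using exponential_expectation_cos[OF _ dt[of n], of "1 / s"] \<open>l > 0\<close>
        by (simp add: s_def)
    qed
    moreover have "\<bar>a\<bar> < 1" using s \<open>l > 0\<close> pos by (simp add: a_def)
    moreover have "(1 + a) / (1 - a) = 1 + 2 * ((\<sigma> i)\<^sup>2 / l\<^sup>2)"
    proof -
      have "s\<^sup>2 + l\<^sup>2 \<noteq> 0" using pos by linarith
      then have "1 + a = (2 * s\<^sup>2 + l\<^sup>2) / (s\<^sup>2 + l\<^sup>2)" "1 - a = l\<^sup>2 / (s\<^sup>2 + l\<^sup>2)"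
        unfolding a_def
        by (simp_all add: add_divide_distrib[symmetric] diff_divide_eq_iff add_divide_eq_iff)
      then have "(1 + a) / (1 - a) = (2 * s\<^sup>2 + l\<^sup>2) / l\<^sup>2"
        using \<open>s\<^sup>2 + l\<^sup>2 \<noteq> 0\<close> by simp
      then show ?thesis using \<open>l > 0\<close> by (simp add: s_def add_divide_distrib)
    qed
    ultimately show ?thesis using chain_IAC[OF chain assms(4) s(2), of a] by simp
  qed
  have HMC: "autocovariance_summable M ?q \<and>
      has_asymptotic_variance M ?q (autocovariance_series M ?q) \<and>
      IAC M (\<sigma> i) ?q = (1 + cos (l / \<sigma> i)) / (1 - cos (l / \<sigma> i))"
    if H: "stationary_HMC M D \<sigma> l q0 \<xi> dt" and l: "\<forall>k::int. l \<noteq> of_int k * (pi * \<sigma> i)"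
  proof -
    from H have chain: "stationary_chain M D \<sigma> q0 \<xi> dt" and dt: "\<And>n. dt n = (\<lambda>_. l)"
      by (auto simp: stationary_HMC_def)
    interpret prob_space M using chain by (simp add: stationary_chain_def)
    have "sin (l / \<sigma> i) \<noteq> 0"
    proof
      assume "sin (l / \<sigma> i) = 0"
      then obtain k :: int where "l / \<sigma> i = of_int k * pi" by (auto simp: sin_zero_iff_int2)
      then have "l = of_int k * (pi * \<sigma> i)" using s by (simp add: field_simps)
      with l show False by blast
    qed
    then have "(sin (l / \<sigma> i))\<^sup>2 > 0" by simp
    then have "(cos (l / \<sigma> i))\<^sup>2 < 1" using sin_cos_squared_add[of "l / \<sigma> i"] by linarith
    then have "\<bar>cos (l / \<sigma> i)\<bar> < 1" by (simp add: abs_square_less_1)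
    then show ?thesis
      using chain_IAC[OF chain assms(4) s(2), of "cos (l / \<sigma> i)"] by (simp add: dt prob_space)
  qed
  show ?thesis using RHMC HMC by blast
qed

end
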